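(* Let $n\ge 2$ be an integer, let $m\le M$ be real numbers and let $x_1,\dots,x_n$ be real numbers with $m\le x_i\le M$ for $i=1,\dots,n$. Let $\overline{x}=\frac1n\sum_{i=1}^n x_i$, $m_4=\frac1n\sum_{i=1}^n (x_i-\overline{x})^4$ and $I=\{1,2,\dots,n-1\}$. Then $$m_4\le \max_{j\in I}\frac{j(n-j)(n^2-3nj+3j^2)}{n^4}\,(M-m)^4.$$
   Context: $m_4$ denotes the fourth central moment of $x_1,\dots,x_n$; $m$ (without subscript) is a lower bound for the $x_i$. *)

theory Defs
  imports Complex_Main
begin

definition sample_mean :: "nat \<Rightarrow> (nat \<Rightarrow> real) \<Rightarrow> real" where
  "sample_mean n x = (1 / real n) * (\<Sum>i = 1..n. x i)"

definition central_moment :: "nat \<Rightarrow> nat \<Rightarrow> (nat \<Rightarrow> real) \<Rightarrow> real" where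
  "central_moment r n x = (1 / real n) * (\<Sum>i = 1..n. (x i - sample_mean n x) ^ r)"

end

theory Submission
  imports Defs "HOL-Analysis.Convex"
begin

text \<open>An even central moment is convex in each data point separately, so over the cube
  \<open>[m, M]\<^sup>n\<close> it is maximal at a vertex. At a vertex with \<open>j\<close> coordinates
  equal to \<open>M\<close> and \<open>p = j / n\<close>, the fourth moment is
  \<open>(p (1 - p)\<^sup>4 + (1 - p) p\<^sup>4) (M - m)\<^sup>4\<close>, which vanishes for \<open>j = 0\<close> and \<open>j = n\<close>.\<close>

lemma sample_mean_linear:
  fixes u v :: real
  shows "sample_mean n (\<lambda>k. u * x k + v * y k) = u * sample_mean n x + v * sample_mean n y"
  by (simp add: sample_mean_def sum.distrib sum_distrib_left algebra_simps)

text \<open>Changing coordinate \<open>i\<close> also moves the mean, but every deviation from the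
  mean stays affine in \<open>t\<close>. An even power of an affine function is convex, and
  averaging preserves convexity.\<close>

lemma convex_on_central_moment_coord:
  assumes "even r"
  shows "convex_on UNIV (\<lambda>t. central_moment r n (x(i := t)))"
proof (rule convex_onI)
  fix t a b :: real
  assume t: "0 < t" "t < 1"
  let ?d = "\<lambda>c k. (x(i := c)) k - sample_mean n (x(i := c))"
  \<comment> \<open>The weights add up to 1, so the coordinates other than \<open>i\<close> are
    reproduced unchanged; linearity of the mean then applies.\<close>
  have upd: "x(i := (1 - t) * a + t * b) = (\<lambda>k. (1 - t) * (x(i := a)) k + t * (x(i := b)) k)"
    by (auto simp: algebra_simps)
  have d: "?d ((1 - t) * a + t * b) k = (1 - t) * ?d a k + t * ?d b k" for k
    unfolding upd by (simp only: sample_mean_linear) algebra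
  have "?d ((1 - t) * a + t * b) k ^ r \<le> (1 - t) * ?d a k ^ r + t * ?d b k ^ r" for k
    unfolding d using convex_onD[OF convex_power_even[OF assms], of t "?d a k" "?d b k"] t
    by simp
  then have "(\<Sum>k = 1..n. ?d ((1 - t) * a + t * b) k ^ r)
      \<le> (1 - t) * (\<Sum>k = 1..n. ?d a k ^ r) + t * (\<Sum>k = 1..n. ?d b k ^ r)"
    by (simp only: sum_distrib_left flip: sum.distrib) (rule sum_mono)
  then have "1 / real n * (\<Sum>k = 1..n. ?d ((1 - t) * a + t * b) k ^ r)
      \<le> 1 / real n * ((1 - t) * (\<Sum>k = 1..n. ?d a k ^ r) + t * (\<Sum>k = 1..n. ?d b k ^ r))"
    by (rule mult_left_mono) simp
  then show "central_moment r n (x(i := (1 - t) *\<^sub>R a + t *\<^sub>R b))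
      \<le> (1 - t) * central_moment r n (x(i := a)) + t * central_moment r n (x(i := b))"
    unfolding central_moment_def real_scaleR_def by (simp only: algebra_simps)
qed simp

text \<open>A convex function on an interval is bounded by the larger of its endpoint values, so the
  coordinates in \<open>S\<close> can be pushed to endpoints one after another without decreasing
  \<open>f\<close>.\<close>

lemma separately_convex_le_vertex:
  fixes f :: "('a \<Rightarrow> real) \<Rightarrow> real"
  assumes "finite S"
    and conv: "\<And>x i. convex_on {a..b} (\<lambda>t. f (x(i := t)))"
    and "\<And>i. i \<in> S \<Longrightarrow> x i \<in> {a..b}"
  shows "\<exists>y. (\<forall>i\<in>S. y i \<in> {a, b}) \<and> f x \<le> f y"
proof -
  \<comment> \<open>The induction also records that \<open>y\<close> agrees with \<open>x\<close>
    off \<open>S\<close>: the next coordinate to be moved then still has its original value, which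
    lies in \<open>{a..b}\<close>.\<close>
  have "\<exists>y. (\<forall>i\<in>S. y i \<in> {a, b}) \<and> (\<forall>i. i \<notin> S \<longrightarrow> y i = x i) \<and> f x \<le> f y"
    using assms(1,3)
  proof (induction S)
    case empty
    then show ?case by auto
  next
    case (insert i S)
    then obtain y where y: "\<forall>k\<in>S. y k \<in> {a, b}" "\<forall>k. k \<notin> S \<longrightarrow> y k = x k" "f x \<le> f y"
      by auto
    have "y i \<in> {a..b}"
      using insert.prems[of i] insert.hyps y(2) by simp
    then have "f y \<le> max (f (y(i := a))) (f (y(i := b)))"
      using convex_on_le_max[OF conv[of y i], of "y i"] by simp
    then obtain c where c: "c \<in> {a, b}" "f y \<le> f (y(i := c))"
      by (metis insertI1 insertI2 le_max_iff_disj)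
    show ?case
    proof (intro exI[of _ "y(i := c)"] conjI)
      show "f x \<le> f (y(i := c))"
        using y(3) c(2) by (rule order.trans)
    qed (use y(1,2) c(1) in auto)
  qed
  then show ?thesis by blast
qed

text \<open>With \<open>p = j / n\<close> the deviations are \<open>(1 - p) * (b - a)\<close> and
  \<open>- p * (b - a)\<close>. The stated coefficient comes from p (1 - p)^4 + (1 - p) p^4 = p (1 -
  p) ((1 - p)^3 + p^3), where the last factor is 1 - 3 p + 3 p^2.\<close>

lemma central_moment_two_valued:
  fixes a b :: real
  assumes "n > 0" and "\<And>i. i \<in> {1..n} \<Longrightarrow> y i \<in> {a, b}"
  defines "j \<equiv> card {i \<in> {1..n}. y i = b}"
  shows "central_moment 4 n y
    = real j * (real n - real j) * ((real n)^2 - 3 * real n * real j + 3 * (real j)^2) / (real n)^4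
      * (b - a)^4"
proof -
  define J where "J = {i \<in> {1..n}. y i = b}"
  have J: "J \<subseteq> {1..n}" "finite J" "card J = j"
    by (auto simp: J_def j_def)
  \<comment> \<open>Kept general in \<open>g\<close> to serve twice: the identity gives the mean,
    the fourth power of the deviation gives the moment.\<close>
  have sum_y: "(\<Sum>i = 1..n. g (y i)) = real j * g b + (real n - real j) * g a" for g :: "real \<Rightarrow> real"
  proof -
    have "(\<Sum>i = 1..n. g (y i)) = (\<Sum>i\<in>J. g (y i)) + (\<Sum>i\<in>{1..n} - J. g (y i))"
      using J by (simp add: sum.subset_diff add.commute)
    also have "(\<Sum>i\<in>J. g (y i)) = (\<Sum>i\<in>J. g b)"
      by (rule sum.cong) (auto simp: J_def)
    also have "(\<Sum>i\<in>{1..n} - J. g (y i)) = (\<Sum>i\<in>{1..n} - J. g a)"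
      by (rule sum.cong) (use assms(2) in \<open>auto simp: J_def\<close>)
    finally show ?thesis
      using J card_mono[of "{1..n}" J] by (simp add: card_Diff_subset of_nat_diff)
  qed
  have mean: "sample_mean n y = (real j * b + (real n - real j) * a) / real n"
    using sum_y[of "\<lambda>t. t"] by (simp add: sample_mean_def)
  have dev: "b - sample_mean n y = (real n - real j) * (b - a) / real n"
      "a - sample_mean n y = - (real j * (b - a) / real n)"
    using assms(1) by (simp_all add: mean field_simps)
  show ?thesis
    unfolding central_moment_def sum_y[of "\<lambda>t. (t - sample_mean n y) ^ 4"] dev
    using assms(1) by (simp add: field_simps) algebra
qed

theorem theorem2p4:
  fixes n :: nat and m M :: real and x :: "nat \<Rightarrow> real"
  assumes "n \<ge> 2"
    and "m \<le> M"
    and "\<And>i. i \<in> {1..n} \<Longrightarrow> m \<le> x i \<and> x i \<le> M"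
  shows "central_moment 4 n x \<le>
    (MAX j\<in>{1..n - 1}.
      real j * (real n - real j) * ((real n)^2 - 3 * real n * real j + 3 * (real j)^2) / (real n)^4)
    * (M - m)^4"
proof -
  let ?c = "\<lambda>j. real j * (real n - real j) * ((real n)^2 - 3 * real n * real j + 3 * (real j)^2) / (real n)^4"
  have "convex_on {m..M} (\<lambda>t. central_moment 4 n (z(i := t)))" for z i
    by (rule convex_on_subset[OF convex_on_central_moment_coord]) auto
  from separately_convex_le_vertex[of "{1..n}" m M "central_moment 4 n" x, OF _ this]
  obtain y where y: "\<forall>i\<in>{1..n}. y i \<in> {m, M}" and le: "central_moment 4 n x \<le> central_moment 4 n y"
    using assms(3) by auto
  define j where "j = card {i \<in> {1..n}. y i = M}"
  have "j \<le> n"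
    unfolding j_def by (rule order.trans[OF card_mono[of "{1..n}"]]) auto
  have max_ge: "?c i \<le> (MAX j\<in>{1..n - 1}. ?c j)" if "i \<in> {1..n - 1}" for i
    using that by (intro Max_ge) auto
  have "?c j \<le> (MAX j\<in>{1..n - 1}. ?c j)"
  proof (cases "j \<in> {1..n - 1}")
    case True
    then show ?thesis by (rule max_ge)
  next
    case False
    then have "j = 0 \<or> j = n" using \<open>j \<le> n\<close> by auto
    then have "?c j = 0" by auto
    \<comment> \<open>The indices 0 and \<open>n\<close> lie outside the range of the maximum, so a
      nonnegative coefficient inside it must dominate the value 0. Index 1 is in range because
      \<open>n \<ge> 2\<close>.\<close>
    also have "0 \<le> ?c 1"
    proof -
      \<comment> \<open>Completing the square settles the sign of the quadratic factor of
        \<open>?c 1\<close>; the other factor is \<open>real n - 1\<close>.\<close>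
      have "(real n)^2 - 3 * real n + 3 = (real n - 3/2)^2 + 3/4"
        by (simp add: power2_eq_square algebra_simps)
      also have "\<dots> \<ge> 0" by simp
      finally show ?thesis using assms(1) by simp
    qed
    also have "?c 1 \<le> (MAX j\<in>{1..n - 1}. ?c j)"
      using assms(1) by (intro max_ge) auto
    finally show ?thesis .
  qed
  then have "?c j * (M - m)^4 \<le> (MAX j\<in>{1..n - 1}. ?c j) * (M - m)^4"
    by (rule mult_right_mono) simp
  moreover have "central_moment 4 n y = ?c j * (M - m)^4"
    unfolding j_def using assms(1) y by (intro central_moment_two_valued) auto
  ultimately show ?thesis using le by linarith
qed

end
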